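(* Let $\mathcal{C}\subseteq\mathbb{R}^n$ be a compact convex set with vertex set $\mathcal{V}$ and let $\mathbf{x}^{(0)}\in\mathcal{V}$. Given a specific Carathéodory-amenable algorithm (CAA), let $(\alpha^{(T)},\mathcal{S}^{(T)},\mathbf{x}^{(T)})=\mathrm{PM}(\mathbf{x}^{(0)})$ denote the output of its modification with the pivoting meta algorithm (PM). Then $|\mathcal{S}^{(t)}|\le\dim(\mathcal{C})+1$ for all $t\in\{0,1,\dots,T\}$.
   Context: $\dim$ of a set is the dimension of its affine hull. Vertices of $\mathcal{C}$ are its extreme points. $\Delta_{|\mathcal{V}|}$ is the set of finitely supported weight vectors $(\alpha_{\mathbf{s}})_{\mathbf{s}\in\mathcal{V}}$ with nonnegative entries summing to $1$. $[m]=\{1,\dots,m\}$. For $\mathbf{x}\in\mathbb{R}^n$, $\tilde{\mathbf{x}}=(\mathbf{x}^\intercal,0,1)^\intercal\in\mathbb{R}^{n+2}$. $M_{:,i}$ is the $i$th column of $M$. $D_n\in\mathbb{R}^{(n+2)\times(n+1)}$ is the matrix whose first $n$ rows are $(I_n,\mathbf{0})$ and whose last two rows have all entries $1$. A convex-combination update (CCU) is a procedure taking $(\alpha,\mathcal{S},\mathbf{x})$ with $\alpha\in\Delta_{|\mathcal{V}|}$, $\mathcal{S}=\{\mathbf{s}:\alpha_{\mathbf{s}}>0\}$, $\mathbf{x}=\sum_{\mathbf{s}\in\mathcal{S}}\alpha_{\mathbf{s}}\mathbf{s}\in\mathcal{C}$, and returning $(\beta,\mathcal{T},\mathbf{y})$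 with $\beta\in\Delta_{|\mathcal{V}|}$, $\mathcal{T}=\{\mathbf{s}:\beta_{\mathbf{s}}>0\}$, $\mathbf{y}=\sum_{\mathbf{s}\in\mathcal{T}}\beta_{\mathbf{s}}\mathbf{s}\in\mathcal{C}$, such that either $\mathcal{T}\subseteq\mathcal{S}$ or there is exactly one $\mathbf{v}\in\mathcal{T}\setminus\mathcal{S}$ with $\mathcal{T}\subseteq\mathcal{S}\cup\{\mathbf{v}\}$. A Carathéodory-amenable algorithm (CAA) starts at $\mathbf{x}^{(0)}\in\mathcal{V}$ with $\alpha^{(0)}$ concentrated at $\mathbf{x}^{(0)}$ and $\mathcal{S}^{(0)}=\{\mathbf{x}^{(0)}\}$, and for $t=0,\dots,T-1$ sets $(\alpha^{(t+1)},\mathcal{S}^{(t+1)},\mathbf{x}^{(t+1)})=\mathrm{CCU}(\alpha^{(t)},\mathcal{S}^{(t)},\mathbf{x}^{(t)})$. PM applied to a CAA: set $M^{(0)}=(\tilde{\mathbf{x}}^{(0)},D_n)\in\mathbb{R}^{(n+2)\times(n+2)}$, $\alpha^{(0)}$ concentrated at $\mathbf{x}^{(0)}$, $\mathcal{S}^{(0)}=\{\mathbf{x}^{(0)}\}$. For $t=0,\dots,T-1$: $(\beta^{(t+1)},\mathcal{T}^{(t+1)},\mathbf{x}^{(t+1)})=\mathrm{CCU}(\alpha^{(t)},\mathcal{S}^{(t)},\mathbf{x}^{(t)})$ with the CCU of the CAA, then $(M^{(t+1)},\alpha^{(t+1)},\mathcal{S}^{(t+1)})=\mathrm{ASC}(M^{(t)},\beta^{(t+1)},\mathcal{T}^{(t+1)},\mathcal{T}^{(t+1)}\setminus\mathcal{S}^{(t)})$.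 Active set cleanup algorithm $\mathrm{ASC}(N,\beta,\mathcal{T},\mathcal{D})$, where $|\mathcal{D}|\le1$: (i) If $\mathcal{D}=\emptyset$: for $i\in[n+2]$ set $\lambda_i=\beta_{\mathbf{s}}$ if $N_{:,i}=\tilde{\mathbf{s}}$ for some $\mathbf{s}\in\mathcal{T}$, and $\lambda_i=0$ otherwise; set $Q=N$. (ii) If $\mathcal{D}=\{\mathbf{v}\}$: let $A=(N,\tilde{\mathbf{v}})\in\mathbb{R}^{(n+2)\times(n+3)}$; for $i\in[n+3]$ set $\mu_i=\beta_{\mathbf{s}}$ if $A_{:,i}=\tilde{\mathbf{s}}$ for some $\mathbf{s}\in\mathcal{T}$, and $\mu_i=0$ otherwise; let $\mathbf{r}=-N^{-1}\tilde{\mathbf{v}}$, choose $k\in\arg\min_{i\in[n+2],\,r_i<0}(-\mu_i/r_i)$ and put $\theta^*=-\mu_k/r_k\ge0$; set $\lambda_k=\mu_{n+3}+\theta^*$ and $\lambda_i=\mu_i+\theta^*r_i$ for $i\in[n+2]$, $i\ne k$; let $Q$ be $N$ with its $k$th column replaced by $\tilde{\mathbf{v}}$. (iii) In both cases choose $\ell\in\{i\in[n+2]:Q_{n+1,i}\ne0\}$; for $i\in[n+2]$ set $M_{:,i}=Q_{:,i}+Q_{:,\ell}$ if $\lambda_i=0$ and $Q_{n+1,i}=0$, and $M_{:,i}=Q_{:,i}$ otherwise; for $\mathbf{s}\in\mathcal{V}$ set $\alpha_{\mathbf{s}}=\lambda_i$ if there is $i\in[n+2]$ with $\tilde{\mathbf{s}}=M_{:,i}$,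 and $\alpha_{\mathbf{s}}=0$ otherwise; set $\mathcal{S}=\{\mathbf{s}\in\mathcal{V}:\alpha_{\mathbf{s}}>0\}$. Return $(M,\alpha,\mathcal{S})$. *)

theory Defs
  imports "HOL-Analysis.Analysis"
begin

text \<open>
  The sum type \<open>'n + 2\<close> indexes both the rows and the columns of matrices of size
  \<open>(n + 2) \<times> (n + 2)\<close>: \<open>Inl j\<close> stands for the \<open>j\<close>th index, \<open>Inr 1\<close> for index \<open>n + 1\<close> and
  \<open>Inr 2\<close> for index \<open>n + 2\<close> (note \<open>2 = 0 \<noteq> 1\<close> in the type \<open>2\<close>). A matrix \<open>M\<close> has the entry
  \<open>M $ r $ i\<close> in row \<open>r\<close> and column \<open>i\<close>.
\<close>

definition vertices :: "(real^'n) set \<Rightarrow> (real^'n) set" where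
  "vertices C = {v. v extreme_point_of C}"

text \<open>Weight vectors are extended by \<open>0\<close> outside \<open>V\<close>.\<close>

definition weights :: "(real^'n) set \<Rightarrow> (real^'n \<Rightarrow> real) \<Rightarrow> bool" where
  "weights V \<alpha> \<longleftrightarrow>
     finite {s. \<alpha> s \<noteq> 0} \<and> {s. \<alpha> s \<noteq> 0} \<subseteq> V \<and> (\<forall>s. 0 \<le> \<alpha> s) \<and>
     (\<Sum>s | \<alpha> s \<noteq> 0. \<alpha> s) = 1"

definition point_weight :: "real^'n \<Rightarrow> real^'n \<Rightarrow> real" where
  "point_weight x = (\<lambda>s. if s = x then 1 else 0)"

type_synonym 'n state = "(real^'n \<Rightarrow> real) \<times> (real^'n) set \<times> (real^'n)"

definition valid_state :: "(real^'n) set \<Rightarrow> 'n state \<Rightarrow> bool" where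
  "valid_state C = (\<lambda>(\<alpha>, S, x).
     weights (vertices C) \<alpha> \<and> S = {s. \<alpha> s > 0} \<and> x = (\<Sum>s\<in>S. \<alpha> s *\<^sub>R s) \<and> x \<in> C)"

definition CCU_step :: "(real^'n) set \<Rightarrow> 'n state \<Rightarrow> 'n state \<Rightarrow> bool" where
  "CCU_step C = (\<lambda>(\<alpha>, S, x) (\<beta>, \<T>, y).
     valid_state C (\<beta>, \<T>, y) \<and>
     (\<T> \<subseteq> S \<or> (\<exists>!v. v \<in> \<T> - S \<and> \<T> \<subseteq> S \<union> {v})))"

text \<open>
  A procedure is its input/output relation, so that it may also depend on oracle answers, random
  choices or an iteration counter; deterministic procedures are the functional relations.
\<close>

definition is_CCU :: "(real^'n) set \<Rightarrow> ('n state \<Rightarrow> 'n state \<Rightarrow> bool) \<Rightarrow> bool" where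
  "is_CCU C ccu \<longleftrightarrow>
     (\<forall>st. valid_state C st \<longrightarrow>
        (\<exists>st'. ccu st st') \<and> (\<forall>st'. ccu st st' \<longrightarrow> CCU_step C st st'))"

definition tilde :: "real^'n \<Rightarrow> real^('n::finite + 2)" where
  "tilde x = (\<chi> i. case i of Inl j \<Rightarrow> x $ j | Inr k \<Rightarrow> if k = 1 then 0 else 1)"

definition D_matrix :: "real^('n::finite + 1)^('n + 2)" where
  "D_matrix = (\<chi> r i. case r of
       Inl j \<Rightarrow> (case i of Inl j' \<Rightarrow> if j = j' then 1 else 0 | Inr _ \<Rightarrow> 0)
     | Inr _ \<Rightarrow> 1)"

text \<open>
  The matrix with columns \<open>tilde x\<close> and those of \<open>D_matrix\<close>. The order of the columns plays no role
  in the algorithm; here \<open>tilde x\<close> is put last, at index \<open>Inr 2\<close>.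
\<close>

definition initial_matrix :: "real^'n \<Rightarrow> real^('n::finite + 2)^('n + 2)" where
  "initial_matrix x = (\<chi> r i. case i of
       Inl j \<Rightarrow> D_matrix $ r $ Inl j
     | Inr k \<Rightarrow> if k = 1 then D_matrix $ r $ Inr 1 else tilde x $ r)"

definition append_column :: "real^'c^'r \<Rightarrow> real^'r \<Rightarrow> real^('c::finite + 1)^'r" where
  "append_column N v = (\<chi> r i. case i of Inl j \<Rightarrow> N $ r $ j | Inr _ \<Rightarrow> v $ r)"

definition replace_column :: "real^'c^'r \<Rightarrow> 'c \<Rightarrow> real^'r \<Rightarrow> real^'c^'r" where
  "replace_column N k v = (\<chi> r i. if i = k then v $ r else N $ r $ i)"

text \<open>The \<open>THE\<close> is justified by the injectivity of \<open>tilde\<close>.\<close>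

definition column_weight ::
    "(real^'n \<Rightarrow> real) \<Rightarrow> (real^'n) set \<Rightarrow> real^('n::finite + 2) \<Rightarrow> real" where
  "column_weight \<beta> \<T> c =
     (if \<exists>s\<in>\<T>. c = tilde s then \<beta> (THE s. s \<in> \<T> \<and> c = tilde s) else 0)"

text \<open>
  The active set cleanup algorithm makes choices (of \<open>k\<close> and of \<open>l\<close>), hence it is a relation
  between inputs and outputs. Here \<open>w\<close> is the vector written \<open>\<lambda>\<close> on paper.
\<close>

definition ASC_keep ::
    "real^('n::finite + 2)^('n + 2) \<Rightarrow> (real^'n \<Rightarrow> real) \<Rightarrow> (real^'n) set \<Rightarrow>
     ('n + 2 \<Rightarrow> real) \<Rightarrow> real^('n + 2)^('n + 2) \<Rightarrow> bool" where
  "ASC_keep N \<beta> \<T> w Q \<longleftrightarrow> w = (\<lambda>i. column_weight \<beta> \<T> (column i N)) \<and> Q = N"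

definition ASC_pivot ::
    "real^('n::finite + 2)^('n + 2) \<Rightarrow> (real^'n \<Rightarrow> real) \<Rightarrow> (real^'n) set \<Rightarrow> real^'n \<Rightarrow>
     ('n + 2 \<Rightarrow> real) \<Rightarrow> real^('n + 2)^('n + 2) \<Rightarrow> bool" where
  "ASC_pivot N \<beta> \<T> v w Q \<longleftrightarrow>
     (let A = append_column N (tilde v);
          \<mu> = (\<lambda>i. column_weight \<beta> \<T> (column i A));
          r = - (matrix_inv N *v tilde v)
      in \<exists>k. is_arg_min (\<lambda>i. - \<mu> (Inl i) / r $ i) (\<lambda>i. r $ i < 0) k \<and>
           (let \<theta> = - \<mu> (Inl k) / r $ k
            in w = (\<lambda>i. if i = k then \<mu> (Inr 1) + \<theta> else \<mu> (Inl i) + \<theta> * r $ i)) \<and>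
           Q = replace_column N k (tilde v))"

text \<open>
  The index picked by \<open>SOME\<close> is unique as long as the columns of \<open>M\<close> are distinct.
\<close>

definition ASC_finish ::
    "(real^'n) set \<Rightarrow> ('n::finite + 2 \<Rightarrow> real) \<Rightarrow> real^('n + 2)^('n + 2) \<Rightarrow>
     real^('n + 2)^('n + 2) \<Rightarrow> (real^'n \<Rightarrow> real) \<Rightarrow> (real^'n) set \<Rightarrow> bool" where
  "ASC_finish V w Q M \<alpha> S \<longleftrightarrow>
     (\<exists>l. Q $ Inr 1 $ l \<noteq> 0 \<and>
        M = (\<chi> r i. if w i = 0 \<and> Q $ Inr 1 $ i = 0 then Q $ r $ i + Q $ r $ l else Q $ r $ i)) \<and>
     \<alpha> = (\<lambda>s. if s \<in> V \<and> (\<exists>i. tilde s = column i M)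
              then w (SOME i. tilde s = column i M) else 0) \<and>
     S = {s \<in> V. \<alpha> s > 0}"

definition ASC ::
    "(real^'n) set \<Rightarrow> real^('n::finite + 2)^('n + 2) \<Rightarrow> (real^'n \<Rightarrow> real) \<Rightarrow> (real^'n) set \<Rightarrow>
     (real^'n) set \<Rightarrow> real^('n + 2)^('n + 2) \<Rightarrow> (real^'n \<Rightarrow> real) \<Rightarrow> (real^'n) set \<Rightarrow> bool" where
  "ASC V N \<beta> \<T> \<D> M \<alpha> S \<longleftrightarrow>
     (\<exists>w Q. (\<D> = {} \<and> ASC_keep N \<beta> \<T> w Q \<or> (\<exists>v. \<D> = {v} \<and> ASC_pivot N \<beta> \<T> v w Q)) \<and>
            ASC_finish V w Q M \<alpha> S)"

text \<open>
  A Caratheodory-amenable algorithm on \<open>C\<close> is given by its starting vertex \<open>x0\<close>, its update \<open>ccu\<close>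
  and its number \<open>T\<close> of iterations. \<open>PM_run\<close> says that the sequences \<open>M\<close>, \<open>\<alpha>\<close>, \<open>S\<close>, \<open>x\<close> (relevant
  up to index \<open>T\<close>) are the iterates of a run of its modification by the pivoting meta algorithm,
  whose output is \<open>(\<alpha> T, S T, x T)\<close>.
\<close>

definition PM_run ::
    "(real^'n) set \<Rightarrow> ('n state \<Rightarrow> 'n state \<Rightarrow> bool) \<Rightarrow> real^'n \<Rightarrow> nat \<Rightarrow>
     (nat \<Rightarrow> real^('n::finite + 2)^('n + 2)) \<Rightarrow> (nat \<Rightarrow> real^'n \<Rightarrow> real) \<Rightarrow>
     (nat \<Rightarrow> (real^'n) set) \<Rightarrow> (nat \<Rightarrow> real^'n) \<Rightarrow> bool" where
  "PM_run C ccu x0 T M \<alpha> S x \<longleftrightarrow>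
     M 0 = initial_matrix x0 \<and> \<alpha> 0 = point_weight x0 \<and> S 0 = {x0} \<and> x 0 = x0 \<and>
     (\<forall>t<T. \<exists>\<beta> \<T>.
        ccu (\<alpha> t, S t, x t) (\<beta>, \<T>, x (Suc t)) \<and>
        ASC (vertices C) (M t) \<beta> \<T> (\<T> - S t) (M (Suc t)) (\<alpha> (Suc t)) (S (Suc t)))"

end

theory Submission
  imports Defs
begin

text \<open>
  Throughout a run the matrix stays invertible, its row \<open>n + 1\<close> stays nonnegative, and the columns
  vanishing in that row are exactly the lifts of the active points. Lifts of active points are thus
  linearly independent, so that the active points are affinely independent, which bounds their
  number by the dimension plus one. In a pivot step, row \<open>n + 1\<close> of \<open>N r = - tilde v\<close> says that the
  nonnegative combination of the \<open>r\<^sub>i\<close> with coefficients from that row is \<open>0\<close>; hence either some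
  column of weight \<open>0\<close> has \<open>r\<^sub>i < 0\<close> and the step length is \<open>0\<close>, or \<open>r\<^sub>i = 0\<close> for all columns that
  are not lifts. Either way only lifts receive a nonzero weight.
\<close>

section \<open>Lifted points\<close>

lemma tilde_nth [simp]:
  "tilde x $ Inl j = x $ j" "tilde x $ Inr 1 = 0" "tilde x $ Inr 2 = 1"
  by (simp_all add: tilde_def)

lemma all_sum_2: "(\<forall>i::'n + 2. P i) \<longleftrightarrow> (\<forall>j. P (Inl j)) \<and> P (Inr 1) \<and> P (Inr 2)"
  by (simp add: split_sum_all forall_2)

lemma tilde_eq_iff [simp]: "tilde x = tilde y \<longleftrightarrow> x = y"
  by (auto simp: vec_eq_iff all_sum_2)

text \<open>The last coordinate of a lift is 1, so one linear identity between lifts records both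
  the weighted sum of the points and the total weight; row n + 1 only contributes 0 = 0.\<close>

lemma sum_tilde_eq_iff:
  fixes A B :: "(real^'n::finite) set"
  shows "(\<Sum>s\<in>A. a s *\<^sub>R tilde s) = (\<Sum>s\<in>B. b s *\<^sub>R tilde s) \<longleftrightarrow>
    (\<Sum>s\<in>A. a s *\<^sub>R s) = (\<Sum>s\<in>B. b s *\<^sub>R s) \<and> sum a A = sum b B"
  by (simp add: vec_eq_iff all_sum_2)

lemma column_weight_tilde [simp]: "s \<in> T \<Longrightarrow> column_weight \<beta> T (tilde s) = \<beta> s"
  by (auto simp: column_weight_def intro!: arg_cong[where f = \<beta>])

lemma column_weight_eq_0: "c \<notin> tilde ` T \<Longrightarrow> column_weight \<beta> T c = 0"
  by (auto simp: column_weight_def)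

lemma column_weight_nonneg: "(\<And>s. 0 \<le> \<beta> s) \<Longrightarrow> 0 \<le> column_weight \<beta> T c"
  by (auto simp: column_weight_def)

section \<open>Invertible matrices and their columns\<close>

lemma invertible_iff_ker:
  fixes A :: "real^'m^'m"
  shows "invertible A \<longleftrightarrow> (\<forall>z. A *v z = 0 \<longrightarrow> z = 0)"
  by (metis invertible_left_inverse matrix_left_invertible_ker)

lemma matrix_inv_right: "invertible A \<Longrightarrow> A ** matrix_inv A = mat 1"
  unfolding invertible_def matrix_inv_def by (rule conjunct1, rule someI_ex)

lemma invertible_inj_column:
  fixes A :: "real^'m^'m"
  assumes "invertible A"
  shows "inj (\<lambda>i. column i A)"
proof (rule injI)
  fix i j assume "column i A = column j A"
  \<comment> \<open>Two equal columns with different indices would make the difference of the two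
    unit vectors a nonzero kernel vector.\<close>
  then have "A *v axis i 1 = A *v axis j 1"
    by (simp add: matrix_vector_mul_component vec_eq_iff matrix_vector_mult_basis)
  then have "A *v (axis i 1 - axis j 1) = 0"
    by (simp add: matrix_vector_mult_diff_distrib)
  then have "axis i (1::real) - axis j 1 = 0"
    using assms invertible_iff_ker by blast
  then show "i = j"
    by (simp add: axis_eq_axis)
qed

text \<open>Columns that are not lifts of points of \<open>T\<close> get weight 0, and distinctness
  of the columns ensures that no point is counted twice. The weights are arbitrary reals, so the
  coefficients of an affine dependence may be inserted as well.\<close>

lemma column_weight_mult:
  fixes N :: "real^('n::finite + 2)^('n + 2)"
  assumes "invertible N" and "finite T"
  shows "N *v (\<chi> i. column_weight \<beta> T (column i N)) =
    (\<Sum>s | s \<in> T \<and> (\<exists>i. tilde s = column i N). \<beta> s *\<^sub>R tilde s)"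
proof -
  define g where "g c = column_weight \<beta> T c *\<^sub>R c" for c
  define T' where "T' = {s \<in> T. \<exists>i. tilde s = column i N}"
  have "N *v (\<chi> i. column_weight \<beta> T (column i N)) = (\<Sum>i\<in>UNIV. g (column i N))"
    by (simp add: matrix_mult_sum g_def scalar_mult_eq_scaleR)
  also have "\<dots> = sum g (range (\<lambda>i. column i N))"
    using invertible_inj_column[OF assms(1)] by (simp add: sum.reindex)
  also have "\<dots> = sum g (tilde ` T')"
  proof (rule sum.mono_neutral_right)
    show "\<forall>c\<in>range (\<lambda>i. column i N) - tilde ` T'. g c = 0"
    proof
      fix c assume c: "c \<in> range (\<lambda>i. column i N) - tilde ` T'"
      then have "c \<notin> tilde ` T"
        by (auto simp: T'_def image_iff) metis
      then show "g c = 0"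
        by (simp add: g_def column_weight_eq_0)
    qed
  qed (auto simp: T'_def)
  also have "\<dots> = (\<Sum>s\<in>T'. g (tilde s))"
    by (simp add: sum.reindex inj_on_def)
  also have "\<dots> = (\<Sum>s\<in>T'. \<beta> s *\<^sub>R tilde s)"
    by (rule sum.cong) (auto simp: g_def T'_def)
  finally show ?thesis by (simp add: T'_def)
qed

lemma replace_column_mult:
  fixes N :: "real^'m^'m"
  shows "replace_column N k u *v z = N *v (\<chi> i. if i = k then 0 else z $ i) + z $ k *\<^sub>R u"
  by (simp add: vec_eq_iff matrix_vector_mult_def replace_column_def sum.remove[of _ k] if_distrib
      cong: if_cong)

lemma column_replace_column:
  "column i (replace_column N k u) = (if i = k then u else column i N)"
  by (simp add: vec_eq_iff column_def replace_column_def)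

text \<open>With \<open>u = - N r\<close>, the new matrix maps \<open>z\<close> to \<open>N\<close>
  applied to \<open>z\<close> with entry \<open>k\<close> cleared, minus \<open>z $ k\<close> times
  \<open>r\<close>. For a kernel vector this argument of \<open>N\<close> is 0, and its entry
  \<open>k\<close> is \<open>- z $ k * r $ k\<close>.\<close>

lemma invertible_replace_column:
  fixes N :: "real^'m^'m"
  assumes "invertible N" and Nr: "N *v r = - u" and "r $ k \<noteq> 0"
  shows "invertible (replace_column N k u)"
  unfolding invertible_iff_ker
proof (intro allI impI)
  fix z assume 0: "replace_column N k u *v z = 0"
  let ?z = "(\<chi> i. if i = k then 0 else z $ i) - z $ k *\<^sub>R r"
  have "N *v ?z = 0"
    using 0 Nr by (simp add: replace_column_mult matrix_vector_mult_diff_distrib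
        matrix_vector_mult_scaleR)
  then have z0: "?z = 0"
    using assms(1) invertible_iff_ker by blast
  have "z $ k = 0"
    using arg_cong[OF z0, of "\<lambda>v. v $ k"] assms(3) by simp
  then show "z = 0"
    using z0 by (auto simp: vec_eq_iff split: if_splits)
qed

text \<open>Adding column \<open>l\<close> to the columns in \<open>B\<close> is right
  multiplication by the identity plus the rank-one matrix formed from the \<open>l\<close>th unit
  vector and the indicator of \<open>B\<close>.\<close>

lemma add_column_mult:
  fixes Q :: "real^'m^'m"
  shows "(\<chi> r i. if i \<in> B then Q $ r $ i + Q $ r $ l else Q $ r $ i) *v z =
    Q *v (z + (\<Sum>i\<in>B. z $ i) *\<^sub>R axis l 1)"
proof -
  have "(\<Sum>i\<in>UNIV. (if i \<in> B then Q $ r $ i + Q $ r $ l else Q $ r $ i) * z $ i) =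
      (\<Sum>i\<in>UNIV. Q $ r $ i * z $ i) + (\<Sum>i\<in>B. z $ i) * Q $ r $ l" for r
  proof -
    have "(\<Sum>i\<in>UNIV. (if i \<in> B then Q $ r $ i + Q $ r $ l else Q $ r $ i) * z $ i) =
        (\<Sum>i\<in>UNIV. Q $ r $ i * z $ i + (if i \<in> B then z $ i * Q $ r $ l else 0))"
      by (rule sum.cong) (auto simp: algebra_simps)
    then show ?thesis
      by (simp add: sum.distrib sum.If_cases sum_distrib_right)
  qed
  then show ?thesis
    by (simp add: matrix_vector_right_distrib matrix_vector_mult_scaleR matrix_vector_mult_basis
        vec_eq_iff matrix_vector_mult_def[of _ z] column_def)
qed

lemma invertible_add_column:
  fixes Q :: "real^'m^'m"
  assumes "invertible Q" and "l \<notin> B"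
  shows "invertible (\<chi> r i. if i \<in> B then Q $ r $ i + Q $ r $ l else Q $ r $ i)"
  unfolding invertible_iff_ker
proof (intro allI impI)
  fix z
  assume "(\<chi> r i. if i \<in> B then Q $ r $ i + Q $ r $ l else Q $ r $ i) *v z = 0"
  then have z0: "z + (\<Sum>i\<in>B. z $ i) *\<^sub>R axis l 1 = 0"
    using assms(1) invertible_iff_ker unfolding add_column_mult by blast
  have "z $ i = 0" if "i \<noteq> l" for i
    using arg_cong[OF z0, of "\<lambda>v. v $ i"] that by (simp add: axis_def)
  then have "(\<Sum>i\<in>B. z $ i) = 0"
    using assms(2) by (metis sum.neutral)
  then show "z = 0"
    using z0 by simp
qed

section \<open>The invariant\<close>

text \<open>Validity of the state is included because the update is specified on valid states only;
  nonnegativity of row n + 1 is what makes the sign argument in a pivot work.\<close>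

definition PM_invariant ::
    "(real^'n) set \<Rightarrow> real^('n::finite + 2)^('n + 2) \<Rightarrow> 'n state \<Rightarrow> bool" where
  "PM_invariant C M = (\<lambda>(\<alpha>, S, x).
     invertible M \<and> (\<forall>i. 0 \<le> M $ Inr 1 $ i) \<and>
     (\<forall>i. M $ Inr 1 $ i = 0 \<longrightarrow> (\<exists>s\<in>S. column i M = tilde s)) \<and>
     (\<forall>s\<in>S. \<exists>i. tilde s = column i M) \<and> valid_state C (\<alpha>, S, x))"

lemma valid_state_iff:
  "valid_state C (\<alpha>, S, x) \<longleftrightarrow>
     finite S \<and> S \<subseteq> vertices C \<and> S = {s. \<alpha> s > 0} \<and> (\<forall>s. 0 \<le> \<alpha> s) \<and> sum \<alpha> S = 1 \<and>
     x = (\<Sum>s\<in>S. \<alpha> s *\<^sub>R s) \<and> x \<in> C"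
proof -
  have "{s. \<alpha> s \<noteq> 0} = {s. \<alpha> s > 0}" if "\<forall>s. 0 \<le> \<alpha> s"
    using that by (auto simp: less_le)
  then show ?thesis
    by (auto simp: valid_state_def weights_def)
qed

text \<open>An affine dependence of active points is a linear dependence of their lifts. As these
  are columns of \<open>M\<close>, it would give a nonzero kernel vector of an invertible
  matrix.\<close>

lemma PM_invariant_card:
  assumes "PM_invariant C M (\<alpha>, S, x)"
  shows "finite S" and "int (card S) \<le> aff_dim C + 1"
proof -
  have inv: "invertible M" and col: "\<forall>s\<in>S. \<exists>i. tilde s = column i M"
    and fin: "finite S" and SC: "S \<subseteq> C"
    using assms by (auto simp: PM_invariant_def valid_state_iff vertices_def extreme_point_of_def)
  show "finite S" by fact
  have "\<not> affine_dependent S"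
  proof
    assume "affine_dependent S"
    then obtain u s where u: "sum u S = 0" "s \<in> S" "u s \<noteq> 0" "(\<Sum>v\<in>S. u v *\<^sub>R v) = 0"
      unfolding affine_dependent_explicit_finite[OF fin] by blast
    have "{s \<in> S. \<exists>i. tilde s = column i M} = S"
      using col by auto
    then have "M *v (\<chi> i. column_weight u S (column i M)) = (\<Sum>s\<in>S. u s *\<^sub>R tilde s)"
      using column_weight_mult[OF inv fin, of u] by simp
    also have "\<dots> = 0"
      using sum_tilde_eq_iff[of u S "\<lambda>_. 0" "{}"] u by simp
    finally have "(\<chi> i. column_weight u S (column i M)) = 0"
      using inv invertible_iff_ker by blast
    then have 0: "column_weight u S (column i M) = 0" for i
      by (simp add: vec_eq_iff)
    obtain i where "tilde s = column i M"
      using col u(2) by blast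
    then have "u s = 0"
      using 0[of i] column_weight_tilde[OF u(2), of u] by simp
    with u(3) show False ..
  qed
  then have "aff_dim S = int (card S) - 1"
    by (simp add: affine_independent_iff_card)
  then show "int (card S) \<le> aff_dim C + 1"
    using aff_dim_subset[OF SC] by simp
qed

lemma PM_invariant_initial:
  fixes x0 :: "real^'n::finite"
  assumes "x0 \<in> vertices C"
  shows "PM_invariant C (initial_matrix x0) (point_weight x0, {x0}, x0)"
proof -
  have UNIV_2_sum: "(\<Sum>i\<in>UNIV. f i) = (\<Sum>j\<in>UNIV. f (Inl j)) + (f (Inr 1) + f (Inr 2))"
    for f :: "'n + 2 \<Rightarrow> real"
    by (simp add: UNIV_Plus_UNIV[symmetric] sum.Plus sum_2 del: UNIV_Plus_UNIV)
  have "invertible (initial_matrix x0)"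
    unfolding invertible_iff_ker
  proof (intro allI impI)
    fix z :: "real^('n + 2)"
    assume "initial_matrix x0 *v z = 0"
    then have rows: "(\<Sum>i\<in>UNIV. initial_matrix x0 $ r $ i * z $ i) = 0" for r
      by (simp add: vec_eq_iff matrix_vector_mult_def)
    have r1: "(\<Sum>j\<in>UNIV. z $ Inl j) + z $ Inr 1 = 0"
      using rows[of "Inr 1"] by (simp add: UNIV_2_sum initial_matrix_def D_matrix_def)
    have r2: "(\<Sum>j\<in>UNIV. z $ Inl j) + (z $ Inr 1 + z $ Inr 2) = 0"
      using rows[of "Inr 2"] by (simp add: UNIV_2_sum initial_matrix_def D_matrix_def)
    \<comment> \<open>Rows n + 1 and n + 2 differ only in the column of \<open>tilde x0\<close>, so
      their difference isolates this entry.\<close>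
    have z2: "z $ Inr 2 = 0"
      using r1 r2 by simp
    \<comment> \<open>In the first n rows the all-ones column of row n + 1, \<open>Inr 1\<close>,
      has zeros, so only the unit column \<open>Inl j\<close> remains.\<close>
    have zl: "z $ Inl j = 0" for j
      using rows[of "Inl j"] z2
      by (simp add: UNIV_2_sum initial_matrix_def D_matrix_def if_distribR if_distrib cong: if_cong)
    show "z = 0"
      using r1 z2 zl by (simp add: vec_eq_iff all_sum_2)
  qed
  moreover have "column (Inr 2) (initial_matrix x0) = tilde x0"
    by (simp add: vec_eq_iff column_def initial_matrix_def)
  moreover have "initial_matrix x0 $ Inr 1 $ i = (if i = Inr 2 then 0 else 1)" for i
    by (cases i; cases "i = Inr 1"; cases "i = Inr 2")
      (auto simp: initial_matrix_def D_matrix_def, metis exhaust_2)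
  moreover have "valid_state C (point_weight x0, {x0}, x0)"
    using assms by (auto simp: valid_state_iff point_weight_def vertices_def extreme_point_of_def)
  ultimately show ?thesis
    by (auto simp: PM_invariant_def; metis)
qed

text \<open>Both cases of the cleanup end here: it suffices that \<open>w\<close> is nonnegative,
  supported on lifts of vertices, and represents the updated point through \<open>Q\<close>. Adding
  column \<open>l\<close> turns lifts of weight 0 into columns that are no lifts, which leaves
  exactly the lifts of positive weight.\<close>

lemma PM_invariant_finish:
  fixes Q M :: "real^('n::finite + 2)^('n + 2)"
  assumes fin: "ASC_finish (vertices C) w Q M \<alpha> S"
    and inv: "invertible Q" and nonneg: "\<And>i. 0 \<le> Q $ Inr 1 $ i"
    and lift: "\<And>i. Q $ Inr 1 $ i = 0 \<Longrightarrow> \<exists>s\<in>vertices C. column i Q = tilde s"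
    and w: "\<And>i. 0 \<le> w i" and w0: "\<And>i. Q $ Inr 1 $ i \<noteq> 0 \<Longrightarrow> w i = 0"
    and Qw: "Q *v (\<chi> i. w i) = (\<Sum>s\<in>T. \<beta> s *\<^sub>R tilde s)"
    and valid: "valid_state C (\<beta>, T, y)"
  shows "PM_invariant C M (\<alpha>, S, y)"
proof -
  define B where "B = {i. w i = 0 \<and> Q $ Inr 1 $ i = 0}"
  obtain l where l: "Q $ Inr 1 $ l \<noteq> 0"
    and M: "M = (\<chi> r i. if i \<in> B then Q $ r $ i + Q $ r $ l else Q $ r $ i)"
    using fin by (auto simp: ASC_finish_def B_def)
  have \<alpha>: "\<alpha> s = (if s \<in> vertices C \<and> (\<exists>i. tilde s = column i M)
      then w (SOME i. tilde s = column i M) else 0)" for s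
    using fin by (simp add: ASC_finish_def)
  have S: "S = {s \<in> vertices C. \<alpha> s > 0}"
    using fin by (simp add: ASC_finish_def)
  have "l \<notin> B" using l by (simp add: B_def)
  then have invM: "invertible M"
    unfolding M using inv by (rule invertible_add_column[rotated])
  \<comment> \<open>The altered columns carry weight 0, so the alteration does not change the
    combination with coefficients \<open>w\<close>.\<close>
  have "(\<Sum>i\<in>B. (\<chi> i. w i) $ i) = 0"
    by (simp add: B_def)
  then have Mw: "M *v (\<chi> i. w i) = (\<Sum>s\<in>T. \<beta> s *\<^sub>R tilde s)"
    using Qw unfolding M add_column_mult by simp
  have \<alpha>_col: "\<alpha> s = w i" if "s \<in> vertices C" "tilde s = column i M" for s i
  proof -
    have "(SOME i. tilde s = column i M) = i"
      using that(2) invertible_inj_column[OF invM] by (auto simp: inj_def intro!: some_equality)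
    then show ?thesis using that \<alpha> by auto
  qed
  have \<alpha>_nonneg: "0 \<le> \<alpha> s" for s
    using w by (simp add: \<alpha>)
  have S': "S = {s. \<alpha> s > 0}"
    unfolding S by (auto simp: \<alpha> split: if_splits)
  have S_col: "\<exists>i. tilde s = column i M" if "s \<in> S" for s
    using that \<alpha>[of s] by (auto simp: S split: if_splits)
  have "tilde ` S \<subseteq> range (\<lambda>i. column i M)"
    using S_col by auto
  then have "finite (tilde ` S)"
    by (rule finite_subset) simp
  then have finS: "finite S"
    by (rule finite_imageD) (simp add: inj_on_def)
  have M_nonneg: "0 \<le> M $ Inr 1 $ i" for i
    using nonneg by (simp add: M)
  \<comment> \<open>An altered column has the nonzero entry of column \<open>l\<close> in row n + 1;
    a zero there thus means an unaltered lift, outside \<open>B\<close> and hence of positive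
    weight.\<close>
  have colM: "w i > 0 \<and> (\<exists>s\<in>S. column i M = tilde s)" if "M $ Inr 1 $ i = 0" for i
  proof -
    have iB: "i \<notin> B" and Q0: "Q $ Inr 1 $ i = 0"
      using that l by (auto simp: M B_def split: if_splits)
    then have "w i > 0" using w[of i] by (simp add: B_def)
    moreover obtain s where s: "s \<in> vertices C" "column i Q = tilde s"
      using lift[OF Q0] by blast
    moreover have "column i M = column i Q"
      using iB by (simp add: M column_def)
    ultimately show ?thesis using \<alpha>_col[of s i] by (auto simp: S)
  qed
  \<comment> \<open>Recovering \<open>w\<close> from \<alpha> lets \<open>column_weight_mult\<close>
    turn the matrix identity for \<open>w\<close> into one for the returned weights.\<close>
  have "w i = column_weight \<alpha> S (column i M)" for i
  proof (cases "M $ Inr 1 $ i = 0")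
    case True
    then obtain s where "s \<in> S" "column i M = tilde s" using colM by blast
    then show ?thesis using \<alpha>_col[of s i] by (simp add: S)
  next
    case False
    have "column i M \<notin> tilde ` S"
    proof
      assume "column i M \<in> tilde ` S"
      then obtain s where "column i M = tilde s" by blast
      then have "column i M $ Inr 1 = 0" by simp
      with False show False by (simp add: column_def)
    qed
    moreover have "w i = 0"
      using False w0[of i] by (cases "i \<in> B") (auto simp: M B_def)
    ultimately show ?thesis by (simp add: column_weight_eq_0)
  qed
  then have "M *v (\<chi> i. column_weight \<alpha> S (column i M)) = (\<Sum>s\<in>T. \<beta> s *\<^sub>R tilde s)"
    using Mw by simp
  moreover have "{s \<in> S. \<exists>i. tilde s = column i M} = S"
    using S_col by auto
  ultimately have "(\<Sum>s\<in>S. \<alpha> s *\<^sub>R tilde s) = (\<Sum>s\<in>T. \<beta> s *\<^sub>R tilde s)"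
    using column_weight_mult[OF invM finS, of \<alpha>] by simp
  then have "(\<Sum>s\<in>S. \<alpha> s *\<^sub>R s) = y" "sum \<alpha> S = 1" "y \<in> C"
    using valid unfolding sum_tilde_eq_iff valid_state_iff by auto
  moreover have "S \<subseteq> vertices C" using S by blast
  ultimately have "valid_state C (\<alpha>, S, y)"
    using finS S' \<alpha>_nonneg unfolding valid_state_iff by blast
  then show ?thesis
    using invM M_nonneg colM S_col by (simp add: PM_invariant_def)
qed

text \<open>In both cases the task is to verify that the weights \<open>w\<close> represent
  \<open>y\<close> through \<open>Q\<close> and live on lifts; \<open>PM_invariant_finish\<close>
  does the rest.\<close>

lemma PM_invariant_step:
  fixes N M :: "real^('n::finite + 2)^('n + 2)"
  assumes N: "PM_invariant C N (\<alpha>', S', x')"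
    and valid: "valid_state C (\<beta>, T, y)"
    and asc: "ASC (vertices C) N \<beta> T (T - S') M \<alpha> S"
  shows "PM_invariant C M (\<alpha>, S, y)"
proof -
  have inv: "invertible N" and nonneg: "0 \<le> N $ Inr 1 $ i"
    and lift: "N $ Inr 1 $ i = 0 \<Longrightarrow> \<exists>s\<in>S'. column i N = tilde s"
    and col: "s \<in> S' \<Longrightarrow> \<exists>i. tilde s = column i N" and S'V: "S' \<subseteq> vertices C" for i s
    using N by (auto simp: PM_invariant_def valid_state_iff)
  have finT: "finite T" and TV: "T \<subseteq> vertices C" and \<beta>: "0 \<le> \<beta> s" for s
    using valid by (auto simp: valid_state_iff)
  define m where "m i = column_weight \<beta> T (column i N)" for i
  have m_nonneg: "0 \<le> m i" for i
    unfolding m_def by (rule column_weight_nonneg) (rule \<beta>)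
  have m0: "m i = 0" if "N $ Inr 1 $ i \<noteq> 0" for i
  proof -
    have "column i N $ Inr 1 \<noteq> 0" using that by (simp add: column_def)
    then have "column i N \<notin> tilde ` T" by auto
    then show ?thesis by (simp add: m_def column_weight_eq_0)
  qed
  \<comment> \<open>A lift vanishes in row n + 1, so the only lifts among the columns are those of
    old active points. Hence \<open>m\<close> represents the part of \<beta> on
    \<open>T \<inter> S'\<close> and misses a newly added vertex.\<close>
  have S'_iff: "s \<in> S' \<longleftrightarrow> (\<exists>i. tilde s = column i N)" for s
  proof
    assume "\<exists>i. tilde s = column i N"
    then obtain i where i: "tilde s = column i N" ..
    then have "N $ Inr 1 $ i = 0"
      using tilde_nth(2)[of s] by (simp add: column_def)
    then show "s \<in> S'" using lift[of i] i by auto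
  qed (rule col)
  have Nm: "N *v (\<chi> i. m i) = (\<Sum>s\<in>T \<inter> S'. \<beta> s *\<^sub>R tilde s)"
    using column_weight_mult[OF inv finT, of \<beta>] by (simp add: m_def S'_iff Int_def)
  obtain w Q where finish: "ASC_finish (vertices C) w Q M \<alpha> S"
    and wQ: "T - S' = {} \<and> ASC_keep N \<beta> T w Q \<or> (\<exists>v. T - S' = {v} \<and> ASC_pivot N \<beta> T v w Q)"
    using asc by (auto simp: ASC_def)
  from wQ show ?thesis
  proof
    assume *: "T - S' = {} \<and> ASC_keep N \<beta> T w Q"
    then have w: "w = m" and Q: "Q = N" and "T \<inter> S' = T"
      by (auto simp: ASC_keep_def m_def)
    then have "Q *v (\<chi> i. w i) = (\<Sum>s\<in>T. \<beta> s *\<^sub>R tilde s)"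
      using Nm by simp
    moreover have "\<exists>s\<in>vertices C. column i Q = tilde s" if "Q $ Inr 1 $ i = 0" for i
      using lift[of i] S'V that by (auto simp: Q)
    moreover have "invertible Q" "\<And>i. 0 \<le> Q $ Inr 1 $ i" "\<And>i. Q $ Inr 1 $ i \<noteq> 0 \<Longrightarrow> w i = 0"
        "\<And>i. 0 \<le> w i"
      using inv nonneg m0 m_nonneg by (simp_all add: Q w)
    ultimately show ?thesis
      using PM_invariant_finish[OF finish] valid by blast
  next
    assume "\<exists>v. T - S' = {v} \<and> ASC_pivot N \<beta> T v w Q"
    then obtain v where v: "T - S' = {v}" and piv: "ASC_pivot N \<beta> T v w Q" by blast
    have vT: "v \<in> T" using v by blast
    define r where "r = - (matrix_inv N *v tilde v)"
    have col_app: "column (Inl i) (append_column N (tilde v)) = column i N"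
      "column (Inr 1) (append_column N (tilde v)) = tilde v" for i
      by (simp_all add: column_def append_column_def)
    obtain k where k: "is_arg_min (\<lambda>i. - m i / r $ i) (\<lambda>i. r $ i < 0) k"
      and w: "w = (\<lambda>i. if i = k then \<beta> v + - m k / r $ k else m i + - m k / r $ k * r $ i)"
      and Q: "Q = replace_column N k (tilde v)"
      using piv unfolding ASC_pivot_def Let_def r_def[symmetric] col_app m_def[symmetric]
        column_weight_tilde[OF vT] by blast
    define \<theta> where "\<theta> = - m k / r $ k"
    have min: "\<theta> \<le> - m i / r $ i" if "r $ i < 0" for i
      using k that by (auto simp: is_arg_min_linorder \<theta>_def)
    have rk: "r $ k < 0" using k by (simp add: is_arg_min_def)
    have \<theta>: "0 \<le> \<theta>" using m_nonneg[of k] rk by (simp add: \<theta>_def divide_nonneg_neg divide_nonpos_neg)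
    have w_k: "w k = \<beta> v + \<theta>" and w_i: "i \<noteq> k \<Longrightarrow> w i = m i + \<theta> * r $ i" for i
      by (simp_all add: w \<theta>_def)
    \<comment> \<open>Moving the weights by \<theta> along \<open>r\<close> removes \<theta> times
      \<open>tilde v\<close>, which the additional weight \<theta> on the new column
      restores.\<close>
    have Nr: "N *v r = - tilde v"
      using inv by (simp add: r_def linear_neg[OF matrix_vector_mul_linear] matrix_vector_mul_assoc
          matrix_inv_right)
    have "\<theta> * r $ i = 0" if i: "N $ Inr 1 $ i \<noteq> 0" for i
    proof (cases "\<exists>j. N $ Inr 1 $ j \<noteq> 0 \<and> r $ j < 0")
      case True
      then obtain j where "N $ Inr 1 $ j \<noteq> 0" "r $ j < 0" by blast
      \<comment> \<open>The weight \<open>m j\<close> is 0 here, so the ratio at \<open>j\<close> is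
        0 and bounds the minimum.\<close>
      then have "\<theta> \<le> 0" using min[of j] m0[of j] by simp
      with \<theta> show ?thesis by simp
    next
      case False
      have "(\<Sum>j\<in>UNIV. N $ Inr 1 $ j * r $ j) = 0"
        using arg_cong[OF Nr, of "\<lambda>u. u $ Inr 1"] by (simp add: matrix_vector_mult_def)
      moreover have "0 \<le> N $ Inr 1 $ j * r $ j" for j
        using False nonneg[of j] by (cases "N $ Inr 1 $ j = 0") (auto simp: not_less)
      ultimately have "N $ Inr 1 $ i * r $ i = 0"
        by (simp add: sum_nonneg_eq_0_iff)
      with i show ?thesis by simp
    qed
    \<comment> \<open>The index \<open>k\<close> is no exception: its new column
      \<open>tilde v\<close> vanishes in row n + 1.\<close>
    then have w0: "w i = 0" if "Q $ Inr 1 $ i \<noteq> 0" for i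
      using that m0[of i] w_i[of i] by (auto simp: Q replace_column_def split: if_splits)
    have w_nonneg: "0 \<le> w i" for i
    proof (cases "i = k")
      case True
      then show ?thesis using w_k \<beta>[of v] \<theta> by simp
    next
      case False
      \<comment> \<open>This is the ratio test of the simplex method: minimality of \<theta> matters
        exactly where \<open>r\<close> is negative.\<close>
      have "0 \<le> m i + \<theta> * r $ i"
      proof (cases "r $ i < 0")
        case True
        then show ?thesis using min[OF True] by (simp add: field_simps)
      next
        case False
        then show ?thesis using \<theta> m_nonneg[of i] by simp
      qed
      with False show ?thesis by (simp add: w_i)
    qed
    have "Q *v (\<chi> i. w i) = N *v (\<chi> i. if i = k then 0 else w i) + (\<beta> v + \<theta>) *\<^sub>R tilde v"
      by (simp add: Q replace_column_mult w_k cong: if_cong)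
    \<comment> \<open>At \<open>k\<close> the choice of \<theta> gives
      \<open>m k + \<theta> * r $ k = 0\<close>, which matches the cleared entry.\<close>
    also have "(\<chi> i. if i = k then 0 else w i) = (\<chi> i. m i) + \<theta> *\<^sub>R r"
      using rk by (auto simp: vec_eq_iff w_i) (simp add: \<theta>_def)
    also have "N *v \<dots> = (\<Sum>s\<in>T \<inter> S'. \<beta> s *\<^sub>R tilde s) - \<theta> *\<^sub>R tilde v"
      by (simp add: matrix_vector_right_distrib matrix_vector_mult_scaleR Nm Nr)
    also have "\<dots> + (\<beta> v + \<theta>) *\<^sub>R tilde v = (\<Sum>s\<in>T \<inter> S'. \<beta> s *\<^sub>R tilde s) + \<beta> v *\<^sub>R tilde v"
      by (simp add: scaleR_add_left)
    also have "\<dots> = (\<Sum>s\<in>T. \<beta> s *\<^sub>R tilde s)"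
      using sum.Int_Diff[OF finT, of "\<lambda>s. \<beta> s *\<^sub>R tilde s" S'] v by simp
    finally have Qw: "Q *v (\<chi> i. w i) = (\<Sum>s\<in>T. \<beta> s *\<^sub>R tilde s)" .
    have "invertible Q"
      unfolding Q using inv Nr rk by (intro invertible_replace_column) auto
    moreover have "0 \<le> Q $ Inr 1 $ i" for i
      using nonneg by (simp add: Q replace_column_def)
    moreover have "\<exists>s\<in>vertices C. column i Q = tilde s" if "Q $ Inr 1 $ i = 0" for i
    proof (cases "i = k")
      case True
      then show ?thesis using vT TV by (auto simp: Q column_replace_column)
    next
      case False
      then have "N $ Inr 1 $ i = 0" using that by (simp add: Q replace_column_def)
      then show ?thesis using lift[of i] S'V False by (auto simp: Q column_replace_column)
    qed
    ultimately show ?thesis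
      using PM_invariant_finish[OF finish _ _ _ w_nonneg w0 Qw valid] by blast
  qed
qed

theorem corollary5p2:
  fixes C :: "(real^'n) set"
    and ccu :: "'n state \<Rightarrow> 'n state \<Rightarrow> bool"
    and x0 :: "real^'n"
    and T :: nat
    and M :: "nat \<Rightarrow> real^('n::finite + 2)^('n + 2)"
    and \<alpha> :: "nat \<Rightarrow> real^'n \<Rightarrow> real"
    and S :: "nat \<Rightarrow> (real^'n) set"
    and x :: "nat \<Rightarrow> real^'n"
  assumes "compact C" and "convex C"
    and "x0 \<in> vertices C"
    and "is_CCU C ccu"
    and "PM_run C ccu x0 T M \<alpha> S x"
  shows "\<forall>t\<in>{0..T}. finite (S t) \<and> int (card (S t)) \<le> aff_dim C + 1"
proof -
  have "PM_invariant C (M t) (\<alpha> t, S t, x t)" if "t \<le> T" for t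
    using that
  proof (induction t)
    case 0
    then show ?case
      using PM_invariant_initial[OF assms(3)] assms(5) by (simp add: PM_run_def)
  next
    case (Suc t)
    then have IH: "PM_invariant C (M t) (\<alpha> t, S t, x t)" by simp
    obtain \<beta> \<T> where ccu: "ccu (\<alpha> t, S t, x t) (\<beta>, \<T>, x (Suc t))"
      and asc: "ASC (vertices C) (M t) \<beta> \<T> (\<T> - S t) (M (Suc t)) (\<alpha> (Suc t)) (S (Suc t))"
      using Suc.prems assms(5) unfolding PM_run_def by (meson Suc_le_lessD)
    \<comment> \<open>The cleaned-up state, rather than the output of the previous update, is the
      next input of \<open>ccu\<close>; its validity comes from the invariant.\<close>
    have "valid_state C (\<alpha> t, S t, x t)"
      using IH by (simp add: PM_invariant_def)
    then have "CCU_step C (\<alpha> t, S t, x t) (\<beta>, \<T>, x (Suc t))"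
      using assms(4) ccu unfolding is_CCU_def by blast
    then have "valid_state C (\<beta>, \<T>, x (Suc t))"
      by (simp add: CCU_step_def)
    then show ?case
      using PM_invariant_step IH asc by blast
  qed
  then show ?thesis
    using PM_invariant_card by (metis atLeastAtMost_iff)
qed

end
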